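(* Let $n\geq 4$ be an integer. The number of distinct universal cycles for $P_{n,3}$ is equal to \[ (n-3)^{\frac{(n-1)(n-2)}{2}}\,(n-2)^{n-1}\,(n-1)^{\frac{(n-1)(n-2)}{2}-2}\,n^{n-2}\,[(n-3)!]^{n(n-1)}. \]
   Context: For a positive integer $n$ let $[n]=\{1,\ldots,n\}$. For $1\le k\le n$, a $k$-permutation is an ordered sequence of $k$ distinct elements of $[n]$, and $P_{n,k}$ denotes the set of all $k$-permutations of $[n]$, so $|P_{n,k}|=n!/(n-k)!$. A universal cycle for $P_{n,k}$ is a cyclic arrangement (periodic sequence) $(x_1,x_2,\ldots,x_{|P_{n,k}|})$ with each $x_i\in[n]$ such that every $k$-permutation in $P_{n,k}$ appears exactly once as $k$ cyclically consecutive entries. Cyclic arrangements are considered up to rotation, i.e., two universal cycles that differ by a cyclic shift are counted as the same. *)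

theory Defs
  imports Main
begin

definition k_perms :: "nat \<Rightarrow> nat \<Rightarrow> nat list set" where
  "k_perms n k = {p. length p = k \<and> distinct p \<and> set p \<subseteq> {1..n}}"

lemma card_k_perms:
  assumes "k \<le> n"
  shows "card (k_perms n k) = fact n div fact (n - k)"
proof -
  have "card (k_perms n k) = \<Prod>{n - k + 1..n}"
    using card_lists_distinct_length_eq[of "{1..n}" k] assms
    unfolding k_perms_def by simp
  also have "\<dots> = fact n div fact (n - k)"
    using fact_div_fact[of "n - k" n] by simp
  finally show ?thesis .
qed

text \<open>The \<open>k\<close> cyclically consecutive entries of \<open>xs\<close> starting at (0-based) position \<open>i\<close>.\<close>

definition cyclic_window :: "'a list \<Rightarrow> nat \<Rightarrow> nat \<Rightarrow> 'a list" where
  "cyclic_window xs k i = map (\<lambda>j. xs ! ((i + j) mod length xs)) [0..<k]"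

text \<open>A linear representative \<open>(x\<^sub>1, \<dots>, x\<^sub>N)\<close> of a universal cycle, with \<open>N = card (k_perms n k)\<close>.\<close>

definition is_ucycle :: "nat \<Rightarrow> nat \<Rightarrow> nat list \<Rightarrow> bool" where
  "is_ucycle n k xs \<longleftrightarrow>
     length xs = card (k_perms n k) \<and>
     set xs \<subseteq> {1..n} \<and>
     (\<forall>p \<in> k_perms n k. \<exists>!i. i < length xs \<and> cyclic_window xs k i = p)"

definition rotation_rel :: "('a list \<times> 'a list) set" where
  "rotation_rel = {(xs, ys). \<exists>m. ys = rotate m xs}"

lemma equiv_rotation_rel: "equiv UNIV (rotation_rel :: ('a list \<times> 'a list) set)"
proof (rule equivI)
  show "refl (rotation_rel :: ('a list \<times> 'a list) set)"
    unfolding refl_on_def rotation_rel_def by (auto intro: exI[of _ 0])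
  show "sym (rotation_rel :: ('a list \<times> 'a list) set)"
  proof (rule symI)
    fix xs ys :: "'a list"
    assume "(xs, ys) \<in> rotation_rel"
    then obtain m where m: "ys = rotate m xs"
      unfolding rotation_rel_def by auto
    let ?k = "length xs - m mod length xs"
    have "rotate ?k (rotate (m mod length xs) xs) = xs"
    proof (cases "xs = []")
      case False
      then have "m mod length xs \<le> length xs"
        by (simp add: less_imp_le)
      then have "?k + m mod length xs = length xs"
        by simp
      then show ?thesis
        by (simp only: rotate_rotate) (simp add: rotate_id)
    qed simp
    then have "xs = rotate ?k ys"
      unfolding m by (metis rotate_conv_mod)
    then show "(ys, xs) \<in> rotation_rel"
      unfolding rotation_rel_def by blast
  qed
  show "trans (rotation_rel :: ('a list \<times> 'a list) set)"
    unfolding trans_def rotation_rel_def by (auto simp: rotate_rotate)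
qed auto

text \<open>Universal cycles up to rotation: a universal cycle is a full rotation class of lists.\<close>

definition ucycles :: "nat \<Rightarrow> nat \<Rightarrow> nat list set set" where
  "ucycles n k = {xs. is_ucycle n k xs} // rotation_rel"

end

theory Submission
  imports Defs "Jordan_Normal_Form.Determinant"
begin

text \<open>Universal cycles for 3-permutations are the Eulerian circuits of the digraph on ordered pairs
  with arcs \<open>(a, b) \<rightarrow> (b, c)\<close>. The number of Eulerian trails ending at \<open>w\<close> equals the Laplacian
  minor at \<open>w\<close> times a product of factorials of out-degrees (the BEST theorem). It is proved directly
  for the minor, by induction on the number of arcs: both sides satisfy the same recursion when the
  first arc of the trail is deleted, because the determinant is linear in each row.
  The Laplacian has the form \<open>x + \<tau> - U R\<close>, where \<open>x = n - 2\<close>, \<open>\<tau>\<close> exchanges the entries of a pair and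
  \<open>U R\<close> has rank \<open>n\<close>; multiplying by \<open>x - \<tau>\<close> and applying Sylvester's determinant identity leaves
  an \<open>n\<close> by \<open>n\<close> determinant of a scalar matrix plus a matrix of rank one.\<close>

section \<open>Determinants over finite index sets\<close>

text \<open>An arbitrary but fixed order of \<open>S\<close>. Rows and columns of
  \<open>set_mat S S A\<close> follow the same order, so \<open>Det S A\<close> is independent of
  the choice.\<close>

definition enum_of :: "'v set \<Rightarrow> nat \<Rightarrow> 'v" where
  "enum_of S = (SOME h. bij_betw h {0..<card S} S)"

definition set_mat :: "'u set \<Rightarrow> 'v set \<Rightarrow> ('u \<Rightarrow> 'v \<Rightarrow> 'a) \<Rightarrow> 'a mat" where
  "set_mat S T A = mat (card S) (card T) (\<lambda>(i, j). A (enum_of S i) (enum_of T j))"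

definition Det :: "'v set \<Rightarrow> ('v \<Rightarrow> 'v \<Rightarrow> 'a::comm_ring_1) \<Rightarrow> 'a" where
  "Det S A = det (set_mat S S A)"

lemma bij_betw_enum_of: "finite S \<Longrightarrow> bij_betw (enum_of S) {0..<card S} S"
  unfolding enum_of_def by (rule someI_ex[OF ex_bij_betw_nat_finite])

lemma enum_of_in: "finite S \<Longrightarrow> i < card S \<Longrightarrow> enum_of S i \<in> S"
  using bij_betwE[OF bij_betw_enum_of, of S] by auto

lemma enum_of_eq_iff:
  "finite S \<Longrightarrow> i < card S \<Longrightarrow> j < card S \<Longrightarrow> enum_of S i = enum_of S j \<longleftrightarrow> i = j"
  using bij_betw_imp_inj_on[OF bij_betw_enum_of, of S] by (auto dest: inj_onD)

lemma enum_of_surj: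
  assumes "finite S" "v \<in> S"
  obtains i where "i < card S" "enum_of S i = v"
  using bij_betw_imp_surj_on[OF bij_betw_enum_of[OF assms(1)]] assms(2) that
  by (metis atLeastLessThan_iff imageE)

lemma sum_enum_of: "finite S \<Longrightarrow> (\<Sum>i\<in>{0..<card S}. f (enum_of S i)) = sum f S"
  by (rule sum.reindex_bij_betw[OF bij_betw_enum_of])

lemma set_mat_carrier [simp]: "set_mat S T A \<in> carrier_mat (card S) (card T)"
  by (simp add: set_mat_def)

lemma set_mat_cong:
  assumes "finite S" "finite T" "\<And>i j. i \<in> S \<Longrightarrow> j \<in> T \<Longrightarrow> A i j = B i j"
  shows "set_mat S T A = set_mat S T B"
  using assms by (auto simp: set_mat_def enum_of_in)

lemma Det_cong:
  assumes "finite S" "\<And>i j. i \<in> S \<Longrightarrow> j \<in> S \<Longrightarrow> A i j = B i j"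
  shows "Det S A = Det S B"
  unfolding Det_def using set_mat_cong[of S S A B] assms by simp

lemma set_mat_mult:
  fixes A :: "'u \<Rightarrow> 'v \<Rightarrow> 'a::semiring_0"
  assumes "finite T"
  shows "set_mat S T A * set_mat T U B = set_mat S U (\<lambda>i k. \<Sum>j\<in>T. A i j * B j k)"
  by (rule eq_matI)
     (auto simp: set_mat_def scalar_prod_def sum_enum_of[OF assms, symmetric])

lemma Det_mult:
  assumes "finite S"
  shows "Det S (\<lambda>i k. \<Sum>j\<in>S. A i j * B j k) = Det S A * Det S B"
  unfolding Det_def set_mat_mult[OF assms, symmetric] by (rule det_mult[where n = "card S"]) simp_all

lemma Det_diagonal:
  assumes S: "finite S"
  shows "Det S (\<lambda>i j. if i = j then d i else 0) = prod d S"
proof -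
  let ?M = "set_mat S S (\<lambda>i j. if i = j then d i else 0)"
  have "det ?M = prod_list (diag_mat ?M)"
    by (rule det_upper_triangular[where n = "card S"])
       (auto simp: set_mat_def upper_triangular_def enum_of_eq_iff[OF S])
  also have "\<dots> = (\<Prod>i\<in>{0..<card S}. d (enum_of S i))"
    unfolding prod_list_diag_prod by (rule prod.cong) (auto simp: set_mat_def)
  also have "\<dots> = prod d S"
    by (rule prod.reindex_bij_betw[OF bij_betw_enum_of[OF S]])
  finally show ?thesis by (simp add: Det_def)
qed

section \<open>Linearity in one row and singular matrices\<close>

text \<open>Laplace expansion along row \<open>u\<close>: the cofactors of a row do not involve its
  entries, so one coefficient vector \<open>c\<close> serves every \<open>r\<close>.\<close>

lemma Det_row_linear:
  assumes S: "finite S" and u: "u \<in> S"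
  obtains c where "\<And>r. Det S (A(u := r)) = (\<Sum>y\<in>S. r y * c y)"
proof -
  obtain k where k: "k < card S" "enum_of S k = u"
    using enum_of_surj[OF S u] .
  let ?M = "\<lambda>r. set_mat S S (A(u := r))"
  let ?c = "\<lambda>y. cofactor (set_mat S S A) k (the_inv_into {0..<card S} (enum_of S) y)"
  have inv: "the_inv_into {0..<card S} (enum_of S) (enum_of S j) = j" if "j < card S" for j
    using the_inv_into_f_f[OF bij_betw_imp_inj_on[OF bij_betw_enum_of[OF S]]] that by simp
  have cof: "cofactor (?M r) k j = cofactor (set_mat S S A) k j" if "j < card S" for r j
  proof -
    have "mat_delete (?M r) k j = mat_delete (set_mat S S A) k j"
      unfolding mat_delete_def set_mat_def
      by (rule eq_matI) (use k enum_of_eq_iff[OF S] in auto)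
    then show ?thesis by (simp add: cofactor_def)
  qed
  have "Det S (A(u := r)) = (\<Sum>y\<in>S. r y * ?c y)" for r
  proof -
    have "Det S (A(u := r)) = (\<Sum>j<card S. ?M r $$ (k, j) * cofactor (?M r) k j)"
      unfolding Det_def by (rule laplace_expansion_row[OF set_mat_carrier k(1)])
    also have "\<dots> = (\<Sum>j<card S. ?M r $$ (k, j) * cofactor (set_mat S S A) k j)"
      by (rule sum.cong) (simp_all add: cof)
    also have "\<dots> = (\<Sum>j\<in>{0..<card S}. r (enum_of S j) * ?c (enum_of S j))"
      by (rule sum.cong) (use k cof in \<open>auto simp: set_mat_def inv\<close>)
    also have "\<dots> = (\<Sum>y\<in>S. r y * ?c y)" by (rule sum_enum_of[OF S])
    finally show ?thesis .
  qed
  then show ?thesis by (rule that)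
qed

lemma Det_row_add:
  assumes "finite S" "u \<in> S"
  shows "Det S (A(u := \<lambda>y. r y + s y)) = Det S (A(u := r)) + Det S (A(u := s))"
  using Det_row_linear[OF assms, of A]
  by (metis (mono_tags, lifting) distrib_right sum.cong sum.distrib)

lemma Det_row_diff:
  assumes "finite S" "u \<in> S"
  shows "Det S (A(u := \<lambda>y. r y - s y)) = Det S (A(u := r)) - Det S (A(u := s))"
  using Det_row_add[OF assms, of A "\<lambda>y. r y - s y" s] by simp

lemma Det_row_sum:
  assumes "finite S" "u \<in> S"
  shows "Det S (A(u := \<lambda>y. \<Sum>e\<in>E. r e y)) = (\<Sum>e\<in>E. Det S (A(u := r e)))"
proof -
  obtain f where f: "\<And>r. Det S (A(u := r)) = (\<Sum>y\<in>S. r y * f y)"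
    using Det_row_linear[OF assms, of A] by metis
  show ?thesis unfolding f sum_distrib_right by (rule sum.swap)
qed

lemma Det_kernel:
  fixes A :: "'v \<Rightarrow> 'v \<Rightarrow> 'a::field"
  assumes S: "finite S" and ker: "\<And>i. i \<in> S \<Longrightarrow> (\<Sum>j\<in>S. A i j * x j) = 0"
    and nz: "z \<in> S" "x z \<noteq> 0"
  shows "Det S A = 0"
proof -
  obtain k where k: "k < card S" "enum_of S k = z" using enum_of_surj[OF S nz(1)] .
  let ?v = "vec (card S) (\<lambda>j. x (enum_of S j))"
  have "?v \<noteq> 0\<^sub>v (card S)"
    using k nz(2) by (auto simp: vec_eq_iff)
  moreover have "set_mat S S A *\<^sub>v ?v = 0\<^sub>v (card S)"
    by (rule eq_vecI) (auto simp: set_mat_def scalar_prod_def sum_enum_of[OF S, of "\<lambda>j. A _ j * x j"] ker enum_of_in[OF S])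
  ultimately show ?thesis unfolding Det_def
    by (subst det_0_iff_vec_prod_zero_field[OF set_mat_carrier]) (auto intro!: exI[of _ ?v])
qed

section \<open>Sylvester's determinant identity\<close>

text \<open>Block elimination in \<open>?X\<close> from both sides. \<open>?X * ?Y\<close> and
  \<open>?Z * ?X\<close> are block triangular; the first shows that \<open>det ?X\<close> is the
  determinant of \<open>c - A B\<close>, the second that \<open>c ^ n * det ?X\<close> is
  \<open>c ^ m\<close> times that of \<open>c - B A\<close>. Keeping the powers of \<open>c\<close>
  avoids division.\<close>

lemma det_sylvester:
  fixes A B :: "'a::idom mat"
  assumes A: "A \<in> carrier_mat m n" and B: "B \<in> carrier_mat n m"
  shows "det (c \<cdot>\<^sub>m 1\<^sub>m m - A * B) * c ^ n = c ^ m * det (c \<cdot>\<^sub>m 1\<^sub>m n - B * A)"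
proof -
  let ?X = "four_block_mat (c \<cdot>\<^sub>m 1\<^sub>m m) A B (1\<^sub>m n)"
  let ?Y = "four_block_mat (1\<^sub>m m) (0\<^sub>m m n) (- B) (1\<^sub>m n)"
  let ?Z = "four_block_mat (1\<^sub>m m) (0\<^sub>m m n) (- B) (c \<cdot>\<^sub>m 1\<^sub>m n)"
  have X: "?X \<in> carrier_mat (m + n) (m + n)" and Y: "?Y \<in> carrier_mat (m + n) (m + n)"
    and Z: "?Z \<in> carrier_mat (m + n) (m + n)"
    using A B by auto
  have AB: "A * B \<in> carrier_mat m m" "B * A \<in> carrier_mat n n"
    by (rule mult_carrier_mat[OF A B]) (rule mult_carrier_mat[OF B A])
  have "?X * ?Y = four_block_mat (c \<cdot>\<^sub>m 1\<^sub>m m * 1\<^sub>m m + A * - B) (c \<cdot>\<^sub>m 1\<^sub>m m * 0\<^sub>m m n + A * 1\<^sub>m n)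
      (B * 1\<^sub>m m + 1\<^sub>m n * - B) (B * 0\<^sub>m m n + 1\<^sub>m n * 1\<^sub>m n)"
    by (rule mult_four_block_mat) (use A B in auto)
  also have "c \<cdot>\<^sub>m 1\<^sub>m m * 1\<^sub>m m + A * - B = c \<cdot>\<^sub>m 1\<^sub>m m - A * B"
    by (rule eq_matI) (use A B in auto)
  also have "c \<cdot>\<^sub>m 1\<^sub>m m * 0\<^sub>m m n + A * 1\<^sub>m n = A"
    by (rule eq_matI) (use A B in auto)
  also have "B * 1\<^sub>m m + 1\<^sub>m n * - B = 0\<^sub>m n m"
    by (rule eq_matI) (use A B in auto)
  also have "B * 0\<^sub>m m n + 1\<^sub>m n * 1\<^sub>m n = 1\<^sub>m n"
    by (rule eq_matI) (use A B in auto)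
  finally have "?X * ?Y = four_block_mat (c \<cdot>\<^sub>m 1\<^sub>m m - A * B) A (0\<^sub>m n m) (1\<^sub>m n)" .
  then have "det ?X * det ?Y = det (c \<cdot>\<^sub>m 1\<^sub>m m - A * B) * det (1\<^sub>m n)"
    using det_four_block_mat_lower_left_zero[OF minus_carrier_mat[OF AB(1)] A refl one_carrier_mat]
    by (simp only: det_mult[OF X Y, symmetric])
  then have XY: "det ?X * det ?Y = det (c \<cdot>\<^sub>m 1\<^sub>m m - A * B)" by simp
  have "?Z * ?X = four_block_mat (1\<^sub>m m * (c \<cdot>\<^sub>m 1\<^sub>m m) + 0\<^sub>m m n * B) (1\<^sub>m m * A + 0\<^sub>m m n * 1\<^sub>m n)
      (- B * (c \<cdot>\<^sub>m 1\<^sub>m m) + c \<cdot>\<^sub>m 1\<^sub>m n * B) (- B * A + c \<cdot>\<^sub>m 1\<^sub>m n * 1\<^sub>m n)"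
    by (rule mult_four_block_mat) (use A B in auto)
  also have "1\<^sub>m m * (c \<cdot>\<^sub>m 1\<^sub>m m) + 0\<^sub>m m n * B = c \<cdot>\<^sub>m 1\<^sub>m m"
    by (rule eq_matI) (use A B in auto)
  also have "1\<^sub>m m * A + 0\<^sub>m m n * 1\<^sub>m n = A"
    by (rule eq_matI) (use A B in auto)
  also have "- B * (c \<cdot>\<^sub>m 1\<^sub>m m) + c \<cdot>\<^sub>m 1\<^sub>m n * B = 0\<^sub>m n m"
    unfolding mult_smult_distrib[OF uminus_carrier_mat[OF B] one_carrier_mat]
      mult_smult_assoc_mat[OF one_carrier_mat B]
    by (rule eq_matI) (use A B in auto)
  also have "- B * A + c \<cdot>\<^sub>m 1\<^sub>m n * 1\<^sub>m n = c \<cdot>\<^sub>m 1\<^sub>m n - B * A"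
    by (rule eq_matI) (use A B in auto)
  finally have "?Z * ?X = four_block_mat (c \<cdot>\<^sub>m 1\<^sub>m m) A (0\<^sub>m n m) (c \<cdot>\<^sub>m 1\<^sub>m n - B * A)" .
  then have "det ?Z * det ?X = det (c \<cdot>\<^sub>m 1\<^sub>m m) * det (c \<cdot>\<^sub>m 1\<^sub>m n - B * A)"
    using det_four_block_mat_lower_left_zero[OF smult_carrier_mat[OF one_carrier_mat] A refl
        minus_carrier_mat[OF AB(2)]]
    by (simp only: det_mult[OF Z X, symmetric])
  then have ZX: "det ?Z * det ?X = c ^ m * det (c \<cdot>\<^sub>m 1\<^sub>m n - B * A)" by simp
  have "det ?Y = det (1\<^sub>m m) * det (1\<^sub>m n)"
    by (rule det_four_block_mat_upper_right_zero[of _ m _ n]) (use B in auto)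
  moreover have "det ?Z = det (1\<^sub>m m) * det (c \<cdot>\<^sub>m 1\<^sub>m n)"
    by (rule det_four_block_mat_upper_right_zero[of _ m _ n]) (use B in auto)
  ultimately show ?thesis using XY ZX by (simp add: mult.commute)
qed

lemma Det_sylvester:
  fixes A :: "'u \<Rightarrow> 'v \<Rightarrow> 'a::idom"
  assumes S: "finite S" and T: "finite T"
  shows "Det S (\<lambda>i j. (if i = j then c else 0) - (\<Sum>k\<in>T. A i k * B k j)) * c ^ card T
    = c ^ card S * Det T (\<lambda>k l. (if k = l then c else 0) - (\<Sum>i\<in>S. B k i * A i l))"
proof -
  have diff: "set_mat U U (\<lambda>i j. (if i = j then c else 0) - M i j)
      = c \<cdot>\<^sub>m 1\<^sub>m (card U) - set_mat U U M" if "finite U" for U :: "'w set" and M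
    by (rule eq_matI) (auto simp: set_mat_def enum_of_eq_iff[OF that])
  show ?thesis
    unfolding Det_def diff[OF S] diff[OF T] set_mat_mult[OF S, symmetric] set_mat_mult[OF T, symmetric]
    by (rule det_sylvester) simp_all
qed

section \<open>Eulerian trails\<close>

definition outdeg :: "('v \<times> 'v) set \<Rightarrow> 'v \<Rightarrow> nat" where
  "outdeg E v = card {e \<in> E. fst e = v}"

definition indeg :: "('v \<times> 'v) set \<Rightarrow> 'v \<Rightarrow> nat" where
  "indeg E v = card {e \<in> E. snd e = v}"

fun walk :: "'v \<Rightarrow> ('v \<times> 'v) list \<Rightarrow> 'v \<Rightarrow> bool" where
  "walk u [] w \<longleftrightarrow> u = w"
| "walk u (e # es) w \<longleftrightarrow> fst e = u \<and> walk (snd e) es w"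

definition trails :: "('v \<times> 'v) set \<Rightarrow> 'v \<Rightarrow> 'v \<Rightarrow> ('v \<times> 'v) list set" where
  "trails E u w = {es. distinct es \<and> set es = E \<and> walk u es w}"

definition delta :: "'v \<Rightarrow> 'v \<Rightarrow> real" where
  "delta v y = (if v = y then 1 else 0)"

text \<open>The Laplacian with the rows of the root \<open>w\<close> and of all sinks replaced by unit vectors, so that
  its determinant over the whole vertex set is the Laplacian minor of the remaining vertices.\<close>

definition rooted_laplacian :: "('v \<times> 'v) set \<Rightarrow> 'v \<Rightarrow> 'v \<Rightarrow> 'v \<Rightarrow> real" where
  "rooted_laplacian E w v y =
    (if v = w \<or> outdeg E v = 0 then delta v y
     else \<Sum>e | e \<in> E \<and> fst e = v. delta v y - delta (snd e) y)"

section \<open>Deletion of an arc\<close>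

lemma finite_trails: "finite E \<Longrightarrow> finite (trails E u w)"
  unfolding trails_def by (rule finite_subset[OF _ finite_subset_distinct]) auto

lemma trails_empty: "trails {} u w = (if u = w then {[]} else {})"
  by (auto simp: trails_def)

lemma trails_step:
  assumes "E \<noteq> {}"
  shows "trails E u w = (\<Union>e\<in>{e \<in> E. fst e = u}. (#) e ` trails (E - {e}) (snd e) w)"
    (is "_ = ?R")
proof (intro equalityI subsetI)
  fix es assume es: "es \<in> trails E u w"
  then obtain e fs where eq: "es = e # fs" using assms by (cases es) (auto simp: trails_def)
  have e: "e \<in> {e \<in> E. fst e = u}" and "fs \<in> trails (E - {e}) (snd e) w"
    using es eq by (auto simp: trails_def)
  then have "es \<in> (#) e ` trails (E - {e}) (snd e) w" unfolding eq by simp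
  with e show "es \<in> ?R" by (rule UN_I)
next
  fix es assume "es \<in> ?R"
  then obtain e fs where eq: "es = e # fs" and e: "e \<in> E" "fst e = u"
    and fs: "fs \<in> trails (E - {e}) (snd e) w" by blast
  have "insert e (E - {e}) = E" using e(1) by blast
  then show "es \<in> trails E u w" using fs e(2) unfolding trails_def eq by simp
qed

text \<open>The recursion behind \<open>card_trails\<close>: the first arc leaves \<open>u\<close>,
  the rest is a trail of the remaining arcs, and different first arcs give disjoint sets.\<close>

lemma card_trails_step:
  assumes "finite E" "E \<noteq> {}"
  shows "card (trails E u w) = (\<Sum>e\<in>{e \<in> E. fst e = u}. card (trails (E - {e}) (snd e) w))"
  unfolding trails_step[OF assms(2)]
  using assms by (subst card_UN_disjoint) (auto simp: finite_trails card_image)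

lemma outdeg_remove:
  assumes "finite E" "e \<in> E"
  shows "outdeg E v = outdeg (E - {e}) v + (if v = fst e then 1 else 0)"
proof -
  have "{e' \<in> E. fst e' = v} =
      (if v = fst e then insert e {e' \<in> E - {e}. fst e' = v} else {e' \<in> E - {e}. fst e' = v})"
    using assms by auto
  then show ?thesis using assms by (simp add: outdeg_def)
qed

lemma indeg_remove:
  assumes "finite E" "e \<in> E"
  shows "indeg E v = indeg (E - {e}) v + (if v = snd e then 1 else 0)"
proof -
  have "{e' \<in> E. snd e' = v} =
      (if v = snd e then insert e {e' \<in> E - {e}. snd e' = v} else {e' \<in> E - {e}. snd e' = v})"
    using assms by auto
  then show ?thesis using assms by (simp add: indeg_def)
qed

text \<open>The row of a vertex depends only on the arcs that leave it.\<close>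

lemma rooted_laplacian_remove:
  assumes "finite E" "e \<in> E" "fst e = u"
  shows "rooted_laplacian (E - {e}) w =
    (rooted_laplacian E w)(u := rooted_laplacian (E - {e}) w u)"
proof
  fix v
  show "rooted_laplacian (E - {e}) w v =
    ((rooted_laplacian E w)(u := rooted_laplacian (E - {e}) w u)) v"
  proof (cases "v = u")
    case False
    then have "{e' \<in> E - {e}. fst e' = v} = {e' \<in> E. fst e' = v}"
      using assms(3) by auto
    moreover have "outdeg (E - {e}) v = outdeg E v"
      using outdeg_remove[OF assms(1,2), of v] False assms(3) by simp
    ultimately show ?thesis using False
      by (auto simp: rooted_laplacian_def fun_eq_iff)
  qed simp
qed

text \<open>The row of the root is a unit vector whatever arcs leave it, so such arcs do not affect
  the minor.\<close>

lemma rooted_laplacian_remove_root: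
  assumes "finite E" "e \<in> E" "fst e = w"
  shows "rooted_laplacian (E - {e}) w = rooted_laplacian E w"
  by (subst rooted_laplacian_remove[OF assms]) (auto simp: rooted_laplacian_def fun_eq_iff)

lemma outdeg_pos_iff: "finite E \<Longrightarrow> 0 < outdeg E v \<longleftrightarrow> (\<exists>e\<in>E. fst e = v)"
  using card_gt_0_iff[of "{e \<in> E. fst e = v}"] unfolding outdeg_def Bex_def by simp

lemma indeg_pos_iff: "finite E \<Longrightarrow> 0 < indeg E v \<longleftrightarrow> (\<exists>e\<in>E. snd e = v)"
  using card_gt_0_iff[of "{e \<in> E. snd e = v}"] unfolding indeg_def Bex_def by simp

lemma sum_delta: "finite V \<Longrightarrow> (\<Sum>y\<in>V. delta v y * x y) = (if v \<in> V then x v else 0)"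
  by (simp add: delta_def if_distrib[of "\<lambda>a. a * _"] sum.delta cong: if_cong)

text \<open>The factorials of the BEST theorem. At a vertex other than \<open>w\<close> the last
  departure belongs to the spanning tree counted by the minor, so only the other departures are
  ordered freely; at \<open>w\<close> all of them are. A sink contributes
  \<open>fact (0 - 1) = 1\<close>.\<close>

definition trail_weight :: "'v set \<Rightarrow> ('v \<times> 'v) set \<Rightarrow> 'v \<Rightarrow> real" where
  "trail_weight V E w = fact (outdeg E w) * (\<Prod>v\<in>V - {w}. fact (outdeg E v - 1))"

lemma trail_weight_remove_root:
  assumes "finite E" "e \<in> E" "fst e = w"
  shows "trail_weight V E w = outdeg E w * trail_weight V (E - {e}) w"
proof -
  have "outdeg E w = Suc (outdeg (E - {e}) w)"
    using outdeg_remove[OF assms(1,2), of w] assms(3) by simp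
  moreover have "(\<Prod>v\<in>V - {w}. fact (outdeg (E - {e}) v - 1)) = (\<Prod>v\<in>V - {w}. fact (outdeg E v - 1) :: real)"
    by (rule prod.cong) (use outdeg_remove[OF assms(1,2)] assms(3) in auto)
  ultimately show ?thesis by (simp add: trail_weight_def)
qed

text \<open>The quotient \<open>fact (d - 1) / fact (d - 2)\<close> is \<open>d - 1\<close> for
  \<open>d \<ge> 2\<close>; truncated subtraction makes it 1 for \<open>d = 1\<close>, whence the
  maximum.\<close>

lemma trail_weight_remove:
  assumes "finite V" "finite E" "e \<in> E" "fst e = u" "u \<in> V" "u \<noteq> w"
  shows "trail_weight V E w = max 1 (outdeg E u - 1) * trail_weight V (E - {e}) w"
proof -
  let ?P = "\<lambda>F. \<Prod>v\<in>V - {w} - {u}. fact (outdeg F v - 1) :: real"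
  have split: "trail_weight V F w = fact (outdeg F w) * (fact (outdeg F u - 1) * ?P F)" for F
    unfolding trail_weight_def using assms by (subst prod.remove[of _ u]) auto
  have "?P (E - {e}) = ?P E"
    by (rule prod.cong) (use outdeg_remove[OF assms(2,3)] assms in auto)
  moreover have "outdeg (E - {e}) w = outdeg E w"
    using outdeg_remove[OF assms(2,3), of w] assms by auto
  moreover have out: "outdeg E u = Suc (outdeg (E - {e}) u)"
    using outdeg_remove[OF assms(2,3), of u] assms by simp
  moreover have "(fact (outdeg E u - 1) :: real)
      = max 1 (outdeg E u - 1) * fact (outdeg (E - {e}) u - 1)"
    unfolding out by (cases "outdeg (E - {e}) u") (auto simp: distrib_right)
  ultimately show ?thesis unfolding split by simp
qed

text \<open>Deleting the first arc in all possible ways changes the row of its tail linearly, so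
  multilinearity of the determinant replaces the usual detour through spanning trees.\<close>

lemma sum_Det_remove:
  assumes V: "finite V" and E: "E \<subseteq> V \<times> V" and loopfree: "\<And>e. e \<in> E \<Longrightarrow> fst e \<noteq> snd e"
    and u: "u \<in> V" "u \<noteq> w" and deg: "outdeg E u = Suc (indeg E u)"
  shows "(\<Sum>e\<in>{e \<in> E. fst e = u}. Det V (rooted_laplacian (E - {e}) w))
    = max 1 (outdeg E u - 1) * Det V (rooted_laplacian E w)"
proof -
  have finE: "finite E" using V E by (meson finite_SigmaI finite_subset)
  define A where "A = {e \<in> E. fst e = u}"
  have finA: "finite A" and cardA: "card A = outdeg E u"
    using finE by (simp_all add: A_def outdeg_def)
  define r where "r e y = delta u y - delta (snd e) y" for e :: "'a \<times> 'a" and y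
  let ?L = "rooted_laplacian E w"
  have Lu: "?L u = (\<lambda>y. \<Sum>e\<in>A. r e y)"
    using u deg by (auto simp: rooted_laplacian_def fun_eq_iff A_def r_def)
  show ?thesis
  proof (cases "outdeg E u = 1")
    case True
    then obtain e where A: "A = {e}" using cardA card_1_singletonE by metis
    have e: "e \<in> E" "fst e = u" using A by (auto simp: A_def)
    \<comment> \<open>With its only arc deleted \<open>u\<close> is a sink, so its row becomes the
      unit vector.\<close>
    have "outdeg (E - {e}) u = 0"
      using outdeg_remove[OF finE e(1), of u] e True by simp
    then have row: "rooted_laplacian (E - {e}) w = ?L(u := delta u)"
      by (subst rooted_laplacian_remove[OF finE e]) (auto simp: rooted_laplacian_def fun_eq_iff)
    \<comment> \<open>Nothing enters \<open>u\<close>, so once its row is replaced by the unit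
      vector at the head of \<open>e\<close> the column of \<open>u\<close> vanishes, and that
      determinant is zero.\<close>
    have "indeg E u = 0" using True deg by simp
    then have no_in: "snd e' \<noteq> u" if "e' \<in> E" for e'
      using indeg_pos_iff[OF finE, of u] that by auto
    have col: "(?L(u := delta (snd e))) i u = 0" for i
      using u no_in[OF e(1)] no_in by (auto simp: rooted_laplacian_def delta_def intro!: sum.neutral)
    have "(\<Sum>j\<in>V. (?L(u := delta (snd e))) i j * delta u j) = 0" for i
    proof (rule sum.neutral, rule ballI)
      fix j
      show "(?L(u := delta (snd e))) i j * delta u j = 0"
        using col[of i] by (cases "u = j") (simp_all add: delta_def)
    qed
    then have zero: "Det V (?L(u := delta (snd e))) = 0"
      by (intro Det_kernel[OF V, of _ "delta u" u]) (auto simp: u delta_def)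
    have "?L = ?L(u := \<lambda>y. delta u y - delta (snd e) y)"
      using Lu A by (auto simp: r_def fun_eq_iff)
    then have "Det V ?L = Det V (?L(u := delta u)) - Det V (?L(u := delta (snd e)))"
      using Det_row_diff[OF V u(1), of ?L "delta u" "delta (snd e)"] by metis
    then show ?thesis using True zero A row by (simp add: A_def[symmetric])
  next
    case False
    \<comment> \<open>Here at least one arc out of \<open>u\<close> remains, so deleting
      \<open>e\<close> subtracts its contribution \<open>r e\<close> from the row.\<close>
    have row: "rooted_laplacian (E - {e}) w = ?L(u := \<lambda>y. ?L u y - r e y)" if "e \<in> A" for e
    proof -
      have e: "e \<in> E" "fst e = u" using that by (auto simp: A_def)
      have "outdeg (E - {e}) u \<noteq> 0"
        using outdeg_remove[OF finE e(1), of u] e False deg by simp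
      moreover have "{e' \<in> E - {e}. fst e' = u} = A - {e}" by (auto simp: A_def)
      ultimately have "rooted_laplacian (E - {e}) w u = (\<lambda>y. ?L u y - r e y)"
        using u that finA unfolding Lu
        by (auto simp: rooted_laplacian_def fun_eq_iff sum_diff1 r_def)
      then show ?thesis by (subst rooted_laplacian_remove[OF finE e]) simp
    qed
    have "(\<Sum>e\<in>A. Det V (rooted_laplacian (E - {e}) w))
        = (\<Sum>e\<in>A. Det V ?L - Det V (?L(u := r e)))"
      by (rule sum.cong) (simp_all add: row Det_row_diff[OF V u(1)])
    \<comment> \<open>The rows \<open>r e\<close> add up to the row of \<open>u\<close>, so one copy
      of the determinant is lost from \<open>outdeg E u\<close> copies.\<close>
    also have "\<dots> = card A * Det V ?L - Det V (?L(u := \<lambda>y. \<Sum>e\<in>A. r e y))"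
      by (simp add: sum_subtractf Det_row_sum[OF V u(1)])
    also have "\<dots> = (real (outdeg E u) - 1) * Det V ?L"
      unfolding Lu[symmetric] by (simp add: cardA algebra_simps)
    also have "real (outdeg E u) - 1 = max 1 (outdeg E u - 1)"
      using False deg by auto
    finally show ?thesis by (simp add: A_def)
  qed
qed

text \<open>The indicator of the vertices with outgoing arcs lies in the kernel: it is zero at the
  root and at the sinks, and by balance every head of an arc has an outgoing arc, so the other rows
  give differences \<open>1 - 1\<close>. This is the case in which a trail is back at
  \<open>w\<close> too early.\<close>

lemma Det_rooted_laplacian_isolated_root:
  assumes V: "finite V" and E: "E \<subseteq> V \<times> V" "E \<noteq> {}"
    and balance: "\<And>v. outdeg E v = indeg E v" and root: "outdeg E w = 0"
  shows "Det V (rooted_laplacian E w) = 0"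
proof -
  have finE: "finite E" using V E(1) by (meson finite_SigmaI finite_subset)
  obtain e where e: "e \<in> E" using E(2) by auto
  define x :: "'a \<Rightarrow> real" where "x v = (if outdeg E v = 0 then 0 else 1)" for v
  show ?thesis
  proof (rule Det_kernel[OF V])
    show "fst e \<in> V" using e E(1) by auto
    show "x (fst e) \<noteq> 0" using e outdeg_pos_iff[OF finE, of "fst e"] by (auto simp: x_def)
    fix v assume v: "v \<in> V"
    show "(\<Sum>y\<in>V. rooted_laplacian E w v y * x y) = 0"
    proof (cases "outdeg E v = 0")
      case True
      then show ?thesis using v by (simp add: rooted_laplacian_def sum_delta[OF V] x_def)
    next
      case False
      have heads: "snd e' \<in> V \<and> x (snd e') = 1" if "e' \<in> E" for e'
        using that E(1) indeg_pos_iff[OF finE, of "snd e'"] balance[of "snd e'"] by (auto simp: x_def)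
      have "(\<Sum>y\<in>V. rooted_laplacian E w v y * x y)
          = (\<Sum>y\<in>V. \<Sum>e' | e' \<in> E \<and> fst e' = v. delta v y * x y - delta (snd e') y * x y)"
        using False root
        by (auto simp: rooted_laplacian_def sum_distrib_right left_diff_distrib intro!: sum.cong)
      also have "\<dots> = (\<Sum>e' | e' \<in> E \<and> fst e' = v. \<Sum>y\<in>V. delta v y * x y - delta (snd e') y * x y)"
        by (rule sum.swap)
      also have "\<dots> = 0"
        using heads v False by (intro sum.neutral) (auto simp: sum_subtractf sum_delta[OF V] x_def)
      finally show ?thesis .
    qed
  qed
qed

text \<open>The BEST theorem, with the minor in place of the number of spanning trees. Deleting the
  first arc moves the start to its head and preserves the degree condition, so the induction ranges
  over open and closed trails alike. Disconnected arcs make both sides zero.\<close>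

theorem card_trails:
  assumes V: "finite V" "w \<in> V"
    and E: "E \<subseteq> V \<times> V" "\<And>e. e \<in> E \<Longrightarrow> fst e \<noteq> snd e" and u: "u \<in> V"
    and balance: "\<And>v. outdeg E v + (if v = w then 1 else 0) = indeg E v + (if v = u then 1 else 0)"
  shows "real (card (trails E u w)) = Det V (rooted_laplacian E w) * trail_weight V E w"
proof -
  have "finite E" using V E(1) by (meson finite_SigmaI finite_subset)
  then show ?thesis using E u balance
  proof (induction E arbitrary: u rule: finite_psubset_induct)
    case (psubset E)
    let ?A = "{e \<in> E. fst e = u}"
    show ?case
    proof (cases "E = {}")
      case True
      have "u = w" using psubset.prems(4)[of w] True
        by (auto simp: outdeg_def indeg_def split: if_splits)
      \<comment> \<open>Every vertex is a sink, so the matrix is the identity.\<close>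
      moreover have "Det V (rooted_laplacian {} w) = Det V (\<lambda>i j. if i = j then 1 else 0)"
        by (rule Det_cong) (auto simp: V rooted_laplacian_def outdeg_def delta_def)
      ultimately show ?thesis using True
        by (simp add: trails_empty Det_diagonal[OF V(1)] trail_weight_def outdeg_def)
    next
      case False
      have "real (card (trails (E - {e}) (snd e) w))
          = Det V (rooted_laplacian (E - {e}) w) * trail_weight V (E - {e}) w" if "e \<in> ?A" for e
      proof (rule psubset.IH)
        show "E - {e} \<subset> E" "E - {e} \<subseteq> V \<times> V" "snd e \<in> V" using that psubset.prems(1) by auto
        show "fst e' \<noteq> snd e'" if "e' \<in> E - {e}" for e' using that psubset.prems(2) by auto
        show "outdeg (E - {e}) v + (if v = w then 1 else 0) = indeg (E - {e}) v + (if v = snd e then 1 else 0)" for v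
          using psubset.prems(4)[of v] outdeg_remove[OF psubset.hyps, of e v]
            indeg_remove[OF psubset.hyps, of e v] that by (auto split: if_splits)
      qed
      then have sum: "real (card (trails E u w))
          = (\<Sum>e\<in>?A. Det V (rooted_laplacian (E - {e}) w) * trail_weight V (E - {e}) w)"
        by (simp add: card_trails_step[OF psubset.hyps False])
      show ?thesis
      proof (cases "u = w")
        case True
        show ?thesis
        proof (cases "outdeg E w = 0")
          case root: True
          then have "?A = {}" using outdeg_pos_iff[OF psubset.hyps, of w] True by auto
          moreover have "Det V (rooted_laplacian E w) = 0"
            by (rule Det_rooted_laplacian_isolated_root)
               (use V False psubset.prems(1,4) root True in auto)
          ultimately show ?thesis using sum by (simp only: sum.empty)
        next
          case root: False
          \<comment> \<open>Each of the \<open>outdeg E w\<close> first arcs contributes the same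
            amount: the minor is unchanged and the weight is divided by
            \<open>outdeg E w\<close>.\<close>
          have "real (card (trails E u w))
            = (\<Sum>e\<in>?A. Det V (rooted_laplacian E w) * trail_weight V E w / outdeg E w)"
            unfolding sum by (rule sum.cong)
              (use True root in \<open>auto simp: rooted_laplacian_remove_root[OF psubset.hyps]
                 trail_weight_remove_root[OF psubset.hyps]\<close>)
          also have "\<dots> = Det V (rooted_laplacian E w) * trail_weight V E w"
            using True root by (simp add: outdeg_def[symmetric])
          finally show ?thesis .
        qed
      next
        case uw: False
        have deg: "outdeg E u = Suc (indeg E u)" using psubset.prems(4)[of u] uw by simp
        let ?m = "real (max 1 (outdeg E u - 1))"
        \<comment> \<open>The factor lost by the weight is the one gained by the sum of
          minors.\<close>
        have "real (card (trails E u w))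
            = (\<Sum>e\<in>?A. Det V (rooted_laplacian (E - {e}) w) * (trail_weight V E w / ?m))"
          unfolding sum
          by (rule sum.cong)
             (use uw psubset.prems(3) in \<open>auto simp: trail_weight_remove[OF V(1) psubset.hyps]\<close>)
        also have "\<dots> = (?m * Det V (rooted_laplacian E w)) * (trail_weight V E w / ?m)"
          unfolding sum_distrib_right[symmetric]
          using sum_Det_remove[OF V(1) psubset.prems(1,2,3) uw deg] by simp
        also have "\<dots> = Det V (rooted_laplacian E w) * trail_weight V E w" by simp
        finally show ?thesis .
      qed
    qed
  qed
qed

section \<open>The graph of overlapping pairs\<close>

definition pairs :: "nat \<Rightarrow> (nat \<times> nat) set" where
  "pairs n = (SIGMA a:{1..n}. {1..n} - {a})"

text \<open>Distinct outer entries exclude the step to the reversed pair, so the arcs correspond to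
  the 3-permutations.\<close>

definition pair_arcs :: "nat \<Rightarrow> ((nat \<times> nat) \<times> (nat \<times> nat)) set" where
  "pair_arcs n = {e. fst e \<in> pairs n \<and> snd e \<in> pairs n \<and>
     snd (fst e) = fst (snd e) \<and> fst (fst e) \<noteq> snd (snd e)}"

lemma finite_pairs [simp]: "finite (pairs n)"
  by (simp add: pairs_def)

lemma card_pairs: "card (pairs n) = n * (n - 1)"
  by (simp add: pairs_def card_SigmaI)

lemma swap_in_pairs [simp]: "prod.swap v \<in> pairs n \<longleftrightarrow> v \<in> pairs n"
  by (cases v) (auto simp: pairs_def)

section \<open>Sums over ordered pairs\<close>

lemma delta_commute: "delta v y = delta y v"
  by (simp add: delta_def)

lemma delta_swap: "delta (prod.swap v) y = delta v (prod.swap y)"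
  by (cases v; cases y) (auto simp: delta_def)

lemma sum_delta_right: "finite V \<Longrightarrow> (\<Sum>y\<in>V. x y * delta y v) = (if v \<in> V then x v else 0)"
  using sum_delta[of V v x] by (simp add: delta_commute[of _ v] mult.commute)

lemma sum_delta_fst:
  assumes "k \<in> {1..n}"
  shows "(\<Sum>v\<in>pairs n. delta k (fst v)) = real (n - 1)"
proof -
  have "(\<Sum>v\<in>pairs n. delta k (fst v)) = real (card {v \<in> pairs n. k = fst v})"
    by (simp add: delta_def sum.If_cases Int_def)
  also have "{v \<in> pairs n. k = fst v} = {k} \<times> ({1..n} - {k})"
    using assms by (auto simp: pairs_def)
  finally show ?thesis using assms by (simp add: card_cartesian_product)
qed

lemma sum_swap_pairs: "(\<Sum>v\<in>pairs n. f (prod.swap v)) = sum f (pairs n)"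
  by (rule sum.reindex_bij_witness[of _ prod.swap prod.swap]) auto

lemma sum_delta_snd:
  assumes "k \<in> {1..n}"
  shows "(\<Sum>v\<in>pairs n. delta k (snd v)) = real (n - 1)"
  using sum_swap_pairs[of "\<lambda>v. delta k (fst v)" n] sum_delta_fst[OF assms] by simp

text \<open>Only \<open>(k, l)\<close> contributes, and it is a pair unless \<open>k = l\<close>.
  With \<open>sum_delta_snd_snd\<close> this gives the entries of the reversed product in the
  Sylvester step.\<close>

lemma sum_delta_fst_snd:
  assumes "k \<in> {1..n}" "l \<in> {1..n}"
  shows "(\<Sum>v\<in>pairs n. delta k (fst v) * delta l (snd v)) = 1 - delta k l"
proof -
  have "(\<Sum>v\<in>pairs n. delta k (fst v) * delta l (snd v)) = (\<Sum>v\<in>pairs n. delta (k, l) v * 1)"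
    by (rule sum.cong) (auto simp: delta_def)
  also have "\<dots> = 1 - delta k l"
    unfolding sum_delta[OF finite_pairs] using assms by (auto simp: pairs_def delta_def)
  finally show ?thesis .
qed

lemma sum_delta_snd_snd:
  assumes "k \<in> {1..n}" "l \<in> {1..n}"
  shows "(\<Sum>v\<in>pairs n. delta k (snd v) * delta l (snd v)) = real (n - 1) * delta k l"
proof -
  have "(\<Sum>v\<in>pairs n. delta k (snd v) * delta l (snd v)) = (\<Sum>v\<in>pairs n. delta k (snd v) * delta k l)"
    by (rule sum.cong) (auto simp: delta_def)
  then show ?thesis by (simp add: sum_distrib_right[symmetric] sum_delta_snd[OF assms(1)])
qed

section \<open>Degrees in the pair digraph\<close>

lemma outdeg_pair_arcs:
  assumes "v \<in> pairs n"
  shows "outdeg (pair_arcs n) v = n - 2"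
proof -
  obtain a b where v: "v = (a, b)" by (cases v)
  have "{e \<in> pair_arcs n. fst e = v} = (\<lambda>c. (v, (b, c))) ` ({1..n} - {a, b})"
    using assms by (auto simp: pair_arcs_def pairs_def v)
  moreover have "card ({1..n} - {a, b}) = n - 2"
    using assms by (auto simp: pairs_def v card_Diff_subset)
  ultimately show ?thesis
    by (simp add: outdeg_def card_image inj_on_def)
qed

lemma indeg_pair_arcs:
  assumes "v \<in> pairs n"
  shows "indeg (pair_arcs n) v = n - 2"
proof -
  obtain b c where v: "v = (b, c)" by (cases v)
  have "{e \<in> pair_arcs n. snd e = v} = (\<lambda>a. ((a, b), v)) ` ({1..n} - {b, c})"
    using assms by (auto simp: pair_arcs_def pairs_def v)
  moreover have "card ({1..n} - {b, c}) = n - 2"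
    using assms by (auto simp: pairs_def v card_Diff_subset)
  ultimately show ?thesis
    by (simp add: indeg_def card_image inj_on_def)
qed

lemma pair_arcs_subset: "pair_arcs n \<subseteq> pairs n \<times> pairs n"
  by (auto simp: pair_arcs_def)

lemma outdeg_outside: "v \<notin> pairs n \<Longrightarrow> outdeg (pair_arcs n) v = 0"
  using pair_arcs_subset[of n] card.empty by (force simp: outdeg_def intro!: card_eq_0_iff[THEN iffD2])

lemma indeg_outside: "v \<notin> pairs n \<Longrightarrow> indeg (pair_arcs n) v = 0"
  using pair_arcs_subset[of n] card.empty by (force simp: indeg_def intro!: card_eq_0_iff[THEN iffD2])

section \<open>Evaluation of the determinant\<close>

text \<open>The Laplacian without a root. \<open>delta (snd v) (fst y)\<close> lets
  \<open>(a, b)\<close> proceed to every \<open>(b, c)\<close>, including the forbidden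
  \<open>(b, a)\<close>; the term with \<open>prod.swap\<close> takes that one back.\<close>

definition pair_laplacian :: "nat \<Rightarrow> nat \<times> nat \<Rightarrow> nat \<times> nat \<Rightarrow> real" where
  "pair_laplacian n v y =
     (real n - 2) * delta v y + delta (prod.swap v) y - delta (snd v) (fst y)"

lemma rooted_laplacian_pair_arcs:
  assumes n: "n \<ge> 3" and v: "v \<in> pairs n" and y: "y \<in> pairs n"
  shows "rooted_laplacian (pair_arcs n) w v y = ((pair_laplacian n)(w := delta w)) v y"
proof (cases "v = w")
  case False
  let ?A = "{e. e \<in> pair_arcs n \<and> fst e = v}"
  have fin: "finite ?A"
    by (rule finite_subset[of _ "pairs n \<times> pairs n"]) (use pair_arcs_subset in auto)
  have "rooted_laplacian (pair_arcs n) w v y = (\<Sum>e\<in>?A. delta v y - delta (snd e) y)"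
    using False n by (simp add: rooted_laplacian_def outdeg_pair_arcs[OF v])
  also have "\<dots> = outdeg (pair_arcs n) v * delta v y - (\<Sum>e\<in>?A. delta (snd e) y)"
    by (simp add: sum_subtractf outdeg_def)
  also have "(\<Sum>e\<in>?A. delta (snd e) y) = (\<Sum>e\<in>?A. if (v, y) = e then 1 else 0)"
    by (rule sum.cong) (auto simp: delta_def)
  also have "\<dots> = (if (v, y) \<in> pair_arcs n then 1 else 0)"
    using fin by (simp add: sum.delta)
  also have "\<dots> = delta (snd v) (fst y) - delta (prod.swap v) y"
    using v y by (auto simp: pair_arcs_def delta_def pairs_def prod_eq_iff)
  finally show ?thesis
    using False n by (simp add: pair_laplacian_def outdeg_pair_arcs[OF v] of_nat_diff)
qed (auto simp: rooted_laplacian_def)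

lemma pair_laplacian_row_sum:
  assumes n: "n \<ge> 3" and v: "v \<in> pairs n"
  shows "(\<Sum>y\<in>pairs n. pair_laplacian n v y) = 0"
proof -
  have "snd v \<in> {1..n}" using v by (auto simp: pairs_def)
  moreover have "(\<Sum>y\<in>pairs n. delta u y) = 1" if "u \<in> pairs n" for u
    using sum_delta[OF finite_pairs, of u "\<lambda>_. 1"] that by simp
  ultimately show ?thesis using v n
    by (simp add: pair_laplacian_def sum.distrib sum_subtractf sum_distrib_left[symmetric]
      sum_delta_fst of_nat_diff)
qed

text \<open>Trades the minor for a determinant without an exceptional unit row. As the rows of the
  Laplacian sum to zero, all unit vectors in the root row give the same value, and a row of ones is
  the sum of all \<open>n * (n - 1)\<close> of them; the Laplacian itself is singular.\<close>

lemma Det_pair_laplacian_root: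
  assumes n: "n \<ge> 3" and w: "w \<in> pairs n"
  shows "Det (pairs n) ((pair_laplacian n)(w := \<lambda>y. pair_laplacian n w y + 1))
    = real (n * (n - 1)) * Det (pairs n) (rooted_laplacian (pair_arcs n) w)"
proof -
  let ?L = "pair_laplacian n" and ?V = "pairs n"
  have unit: "Det ?V (?L(w := delta z)) = Det ?V (?L(w := delta w))" if z: "z \<in> ?V" for z
  proof -
    \<comment> \<open>The all-ones vector lies in the kernel, as the difference of two unit vectors
      also sums to zero.\<close>
    have "Det ?V (?L(w := \<lambda>y. delta z y - delta w y)) = 0"
    proof (rule Det_kernel[OF finite_pairs, where x = "\<lambda>_. 1"])
      fix v assume v: "v \<in> ?V"
      have "(\<Sum>y\<in>?V. delta u y) = 1" if "u \<in> ?V" for u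
        using sum_delta[OF finite_pairs, of u "\<lambda>_. 1"] that by simp
      then show "(\<Sum>y\<in>?V. (?L(w := \<lambda>y. delta z y - delta w y)) v y * 1) = 0"
        using pair_laplacian_row_sum[OF n v] z w by (simp add: sum_subtractf)
    qed (use w in auto)
    then show ?thesis using Det_row_diff[OF finite_pairs w, of ?L "delta z" "delta w"] by simp
  qed
  have "Det ?V (?L(w := \<lambda>y. 1)) = Det ?V (?L(w := \<lambda>y. \<Sum>z\<in>?V. delta z y))"
    by (rule Det_cong) (use sum_delta_right[OF finite_pairs, of "\<lambda>_. 1"] in auto)
  also have "\<dots> = real (card ?V) * Det ?V (?L(w := delta w))"
    unfolding Det_row_sum[OF finite_pairs w] using unit by simp
  finally have one: "Det ?V (?L(w := \<lambda>y. 1)) = real (card ?V) * Det ?V (?L(w := delta w))" .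
  have "Det ?V (?L(w := ?L w)) = 0"
    by (rule Det_kernel[OF finite_pairs, where x = "\<lambda>_. 1"])
       (use pair_laplacian_row_sum[OF n] w in auto)
  moreover have "Det ?V (?L(w := delta w)) = Det ?V (rooted_laplacian (pair_arcs n) w)"
    by (rule Det_cong) (simp_all add: rooted_laplacian_pair_arcs[OF n])
  ultimately show ?thesis
    using Det_row_add[OF finite_pairs w, of ?L "?L w" "\<lambda>y. 1"] one by (simp add: card_pairs)
qed

text \<open>The rank-one instance of the Sylvester identity, over a one-point index set; cancelling
  one \<open>\<alpha>\<close> lowers the exponent from \<open>card P\<close> to
  \<open>m\<close>.\<close>

lemma Det_scalar_minus_column:
  fixes \<alpha> :: real
  assumes "finite P" "\<alpha> \<noteq> 0" "card P = Suc m"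
  shows "Det P (\<lambda>k l. (if k = l then \<alpha> else 0) - q k) = \<alpha> ^ m * (\<alpha> - sum q P)"
proof -
  have "Det P (\<lambda>k l. (if k = l then \<alpha> else 0) - (\<Sum>j\<in>{()}. q k * 1)) * \<alpha> ^ card {()}
    = \<alpha> ^ card P * Det {()} (\<lambda>k l. (if k = l then \<alpha> else 0) - (\<Sum>i\<in>P. 1 * q i))"
    by (rule Det_sylvester) (use assms in auto)
  moreover have "Det {()} (\<lambda>k l. (if k = l then \<alpha> else 0) - sum q P) = \<alpha> - sum q P"
    using Det_diagonal[of "{()}" "\<lambda>_. \<alpha> - sum q P"] by simp
  ultimately show ?thesis using assms by simp
qed

lemma Det_conjugate_signs:
  fixes s :: "'v \<Rightarrow> real"
  assumes S: "finite S" and s: "\<And>v. v \<in> S \<Longrightarrow> s v * s v = 1"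
  shows "Det S (\<lambda>v y. s v * A v y * s y) = Det S A"
proof -
  let ?D = "\<lambda>i j. if i = j then s i else 0"
  have "Det S (\<lambda>v y. s v * A v y * s y)
      = Det S (\<lambda>v y. \<Sum>z\<in>S. (\<Sum>u\<in>S. ?D v u * A u z) * ?D z y)"
    by (rule Det_cong[OF S])
       (simp add: S if_distrib[of "\<lambda>a. a * _"] if_distrib[of "\<lambda>a. _ * a"] sum.delta sum.delta' cong: if_cong)
  also have "\<dots> = prod s S * Det S A * prod s S"
    by (simp only: Det_mult[OF S] Det_diagonal[OF S])
  also have "\<dots> = (\<Prod>v\<in>S. s v * s v) * Det S A"
    by (simp add: prod.distrib)
  finally show ?thesis using s by simp
qed

text \<open>The involution exchanging the two entries satisfies \<open>\<tau>\<^sup>2 = 1\<close>, and conjugation by the sign of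
  \<open>b - a\<close> turns \<open>\<tau>\<close> into \<open>-\<tau>\<close>. Hence \<open>det (x - \<tau>)\<^sup>2 = det (x\<^sup>2 - 1)\<close>; the sign of
  \<open>det (x - \<tau>)\<close> is never needed.\<close>

lemma Det_swap_squared:
  "(Det (pairs n) (\<lambda>v y. x * delta v y - delta (prod.swap v) y))\<^sup>2 = (x\<^sup>2 - 1) ^ card (pairs n)"
proof -
  let ?V = "pairs n"
  let ?K = "\<lambda>v y. x * delta v y - delta (prod.swap v) y"
  let ?K' = "\<lambda>v y. x * delta v y + delta (prod.swap v) y"
  define s :: "nat \<times> nat \<Rightarrow> real" where "s v = (if fst v < snd v then 1 else -1)" for v
  have "Det ?V ?K = Det ?V (\<lambda>v y. s v * ?K' v y * s y)"
    by (rule Det_cong) (auto simp: s_def delta_def pairs_def)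
  also have "\<dots> = Det ?V ?K'"
    by (rule Det_conjugate_signs) (auto simp: s_def)
  finally have "(Det ?V ?K)\<^sup>2 = Det ?V ?K * Det ?V ?K'"
    by (simp add: power2_eq_square)
  also have "\<dots> = Det ?V (\<lambda>v y. \<Sum>z\<in>?V. ?K v z * ?K' z y)"
    by (rule Det_mult[symmetric]) simp
  also have "\<dots> = Det ?V (\<lambda>v y. if v = y then x\<^sup>2 - 1 else 0)"
  proof (rule Det_cong)
    fix v y assume vy: "v \<in> ?V" "y \<in> ?V"
    have "(\<Sum>z\<in>?V. ?K v z * ?K' z y) = x * (\<Sum>z\<in>?V. ?K v z * delta z y) + (\<Sum>z\<in>?V. ?K v z * delta z (prod.swap y))"
      unfolding sum_distrib_left sum.distrib[symmetric]
      by (rule sum.cong) (simp_all add: delta_swap algebra_simps)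
    also have "\<dots> = x * ?K v y + ?K v (prod.swap y)"
      using vy by (simp only: sum_delta_right[OF finite_pairs] swap_in_pairs if_True)
    also have "\<dots> = (if v = y then x\<^sup>2 - 1 else 0)"
      by (simp add: delta_swap) (simp add: delta_def algebra_simps power2_eq_square)
    finally show "(\<Sum>z\<in>?V. ?K v z * ?K' z y) = (if v = y then x\<^sup>2 - 1 else 0)" .
  qed simp
  also have "\<dots> = (x\<^sup>2 - 1) ^ card ?V" by (simp add: Det_diagonal)
  finally show ?thesis .
qed

text \<open>Multiplication by \<open>x - \<tau>\<close> turns the Laplacian into a scalar matrix plus a matrix of rank at
  most \<open>n\<close>, which the Sylvester identity compresses to an \<open>n\<close> by \<open>n\<close> determinant.\<close>

lemma Det_pair_laplacian_mult:
  fixes n :: nat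
  defines "x \<equiv> real n - 2"
  assumes n: "n \<ge> 4" and w: "w \<in> pairs n"
  shows "Det (pairs n) ((pair_laplacian n)(w := \<lambda>y. pair_laplacian n w y + 1))
      * Det (pairs n) (\<lambda>v y. x * delta v y - delta (prod.swap v) y) * (x\<^sup>2 - 1) ^ n
    = (x\<^sup>2 - 1) ^ card (pairs n) * ((real n * x) ^ (n - 1) * (real n - 3))"
proof -
  let ?V = "pairs n" and ?P = "{1..n}" and ?c = "x\<^sup>2 - 1"
  let ?K = "\<lambda>v y. x * delta v y - delta (prod.swap v) y"
  let ?L = "(pair_laplacian n)(w := \<lambda>y. pair_laplacian n w y + 1)"
  \<comment> \<open>\<open>R\<close> consists of the rows that test the first entry, multiplied by
    \<open>x - \<tau>\<close>. The row of ones added at \<open>w\<close> becomes the constant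
    \<open>x - 1\<close>, which is also every column sum of \<open>R\<close>; subtracting
    \<open>delta v w\<close> from every entry of \<open>U\<close> therefore absorbs it without
    enlarging the inner index set.\<close>
  define U where "U v k = delta k (snd v) - delta v w" for v :: "nat \<times> nat" and k
  define R where "R k y = x * delta k (fst y) - delta k (snd y)" for k and y :: "nat \<times> nat"
  have L: "?L v y = x * delta v y + delta (prod.swap v) y - delta (snd v) (fst y) + delta v w" for v y
    by (simp add: pair_laplacian_def x_def delta_def)
  have sumR: "(\<Sum>k\<in>?P. R k y) = x - 1" if "y \<in> ?V" for y
  proof -
    have "(\<Sum>k\<in>?P. R k y) = x * (\<Sum>k\<in>?P. 1 * delta k (fst y)) - (\<Sum>k\<in>?P. 1 * delta k (snd y))"
      by (simp add: R_def sum_subtractf sum_distrib_left)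
    also have "\<dots> = x - 1"
      using that by (subst (1 2) sum_delta_right) (auto simp: pairs_def)
    finally show ?thesis .
  qed
  have "Det ?V ?L * Det ?V ?K = Det ?V (\<lambda>v y. \<Sum>z\<in>?V. ?L v z * ?K z y)"
    by (rule Det_mult[symmetric]) simp
  also have "\<dots> = Det ?V (\<lambda>v y. (if v = y then ?c else 0) - (\<Sum>k\<in>?P. U v k * R k y))"
  proof (rule Det_cong)
    fix v y assume vy: "v \<in> ?V" "y \<in> ?V"
    have "(\<Sum>z\<in>?V. ?L v z * ?K z y)
        = x * (\<Sum>z\<in>?V. ?L v z * delta z y) - (\<Sum>z\<in>?V. ?L v z * delta z (prod.swap y))"
      unfolding sum_distrib_left sum_subtractf[symmetric]
      by (rule sum.cong) (simp_all add: delta_swap algebra_simps)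
    also have "\<dots> = x * ?L v y - ?L v (prod.swap y)"
      using vy by (simp only: sum_delta_right[OF finite_pairs] swap_in_pairs if_True)
    also have "\<dots> = (if v = y then ?c else 0) - (R (snd v) y - delta v w * (x - 1))"
      unfolding L R_def by (simp add: delta_swap) (simp add: delta_def algebra_simps power2_eq_square)
    also have "R (snd v) y - delta v w * (x - 1) = (\<Sum>k\<in>?P. U v k * R k y)"
    proof -
      have "(\<Sum>k\<in>?P. U v k * R k y) = (\<Sum>k\<in>?P. R k y * delta k (snd v)) - delta v w * (\<Sum>k\<in>?P. R k y)"
        by (simp add: U_def algebra_simps sum_subtractf sum_distrib_left)
      moreover have "snd v \<in> ?P" using vy by (auto simp: pairs_def)
      ultimately show ?thesis using sumR[OF vy(2)] by (simp add: sum_delta_right)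
    qed
    finally show "(\<Sum>z\<in>?V. ?L v z * ?K z y) = (if v = y then ?c else 0) - (\<Sum>k\<in>?P. U v k * R k y)" .
  qed simp
  also have "\<dots> * ?c ^ card ?P
      = ?c ^ card ?V * Det ?P (\<lambda>k l. (if k = l then ?c else 0) - (\<Sum>v\<in>?V. R k v * U v l))"
    by (rule Det_sylvester) simp_all
  also have "Det ?P (\<lambda>k l. (if k = l then ?c else 0) - (\<Sum>v\<in>?V. R k v * U v l))
      = Det ?P (\<lambda>k l. (if k = l then real n * x else 0) - (x - R k w))"
  proof (rule Det_cong)
    fix k l assume kl: "k \<in> ?P" "l \<in> ?P"
    have "(\<Sum>v\<in>?V. R k v * U v l) = x * (\<Sum>v\<in>?V. delta k (fst v) * delta l (snd v))
        - (\<Sum>v\<in>?V. delta k (snd v) * delta l (snd v)) - (\<Sum>v\<in>?V. R k v * delta v w)"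
      unfolding U_def R_def sum_distrib_left sum_subtractf[symmetric]
      by (rule sum.cong) (simp_all add: algebra_simps)
    also have "\<dots> = x * (1 - delta k l) - real (n - 1) * delta k l - R k w"
      using kl w by (simp add: sum_delta_fst_snd sum_delta_snd_snd sum_delta_right)
    \<comment> \<open>The diagonal collects \<open>x\<^sup>2 - 1 + x + (n - 1)\<close>, which is
      \<open>n * x\<close> because \<open>n = x + 2\<close>.\<close>
    finally show "(if k = l then ?c else 0) - (\<Sum>v\<in>?V. R k v * U v l)
        = (if k = l then real n * x else 0) - (x - R k w)"
      using n by (cases "k = l") (simp_all add: delta_def x_def of_nat_diff algebra_simps power2_eq_square)
  qed simp
  also have "\<dots> = (real n * x) ^ (n - 1) * (real n * x - (\<Sum>k\<in>?P. x - R k w))"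
    by (rule Det_scalar_minus_column) (use n in \<open>auto simp: x_def\<close>)
  \<comment> \<open>The sum over \<open>k\<close> is \<open>n * x - (x - 1)\<close>, and
    \<open>x - 1\<close> is \<open>n - 3\<close>.\<close>
  also have "real n * x - (\<Sum>k\<in>?P. x - R k w) = real n - 3"
    using sumR[OF w] by (simp add: sum_subtractf x_def)
  finally show ?thesis by (simp add: fun_upd_def)
qed

text \<open>The determinant of \<open>x - \<tau>\<close> is known only up to sign, so the product
  formula is squared and \<open>nonneg\<close> selects the root. That sign comes from the count, in
  which this determinant is multiplied by a positive weight.\<close>

lemma Det_rooted_laplacian_pair_arcs:
  assumes n: "n \<ge> 4" and w: "w \<in> pairs n"
    and nonneg: "Det (pairs n) (rooted_laplacian (pair_arcs n) w) \<ge> 0"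
  shows "Det (pairs n) (rooted_laplacian (pair_arcs n) w) =
    real ((n - 3) ^ ((n - 1) * (n - 2) div 2) * (n - 2) ^ (n - 1) *
      (n - 1) ^ ((n - 1) * (n - 2) div 2 - 2) * n ^ (n - 2))"
proof -
  define t where "t = Det (pairs n) (rooted_laplacian (pair_arcs n) w)"
  define k where "k = Det (pairs n) (\<lambda>v y. (real n - 2) * delta v y - delta (prod.swap v) y)"
  define q where "q = (n - 1) * (n - 2) div 2"
  obtain m where m: "n = m + 4" using n by (metis le_add_diff_inverse2)
  have q2: "2 * q = (n - 1) * (n - 2)" unfolding q_def m
    by (subst dvd_mult_div_cancel) (simp_all add: algebra_simps)
  define c :: real where "c = (real n - 1) * (real n - 3)"
  have c: "(real n - 2)\<^sup>2 - 1 = c" by (simp add: c_def power2_eq_square algebra_simps)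
  have c0: "c > 0" unfolding c_def using n by simp
  \<comment> \<open>An even exponent, so that the right-hand side below becomes a perfect
    square.\<close>
  have N: "card (pairs n) = 2 * (q + (n - 1))"
    unfolding card_pairs using q2 by (simp add: m algebra_simps)
  define \<beta> where "\<beta> = (real n * (real n - 2)) ^ (n - 1) * (real n - 3)"
  have \<beta>: "\<beta> \<ge> 0" unfolding \<beta>_def using n by simp
  have "real (n * (n - 1)) * t * k * c ^ n = c ^ card (pairs n) * \<beta>"
    using Det_pair_laplacian_mult[OF n w] Det_pair_laplacian_root[OF _ w] n
    by (simp add: t_def k_def c \<beta>_def)
  moreover have k2: "k\<^sup>2 = c ^ card (pairs n)"
    using Det_swap_squared[of n "real n - 2"] by (simp add: k_def c)
  \<comment> \<open>After squaring, one of the two powers of \<open>c\<close> on the right is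
    rewritten as \<open>k\<^sup>2\<close>, which then cancels.\<close>
  ultimately have "(real (n * (n - 1)) * t * c ^ n)\<^sup>2 * k\<^sup>2 = c ^ card (pairs n) * \<beta>\<^sup>2 * k\<^sup>2"
    by (metis (no_types, lifting) mult.assoc mult.commute power2_eq_square power_mult_distrib)
  then have "(real (n * (n - 1)) * t * c ^ n)\<^sup>2 = c ^ card (pairs n) * \<beta>\<^sup>2"
    using k2 c0 by simp
  also have "\<dots> = (c ^ (q + (n - 1)) * \<beta>)\<^sup>2"
    unfolding N by (simp add: power_mult_distrib power_mult[symmetric] mult.commute)
  finally have "real (n * (n - 1)) * t * c ^ n = c ^ (q + (n - 1)) * \<beta>"
    using nonneg c0 \<beta> by (subst (asm) power2_eq_iff_nonneg) (auto simp: t_def)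
  moreover have "c ^ n = c ^ (n - 1) * c"
    by (rule power_minus_mult[symmetric]) (simp add: m)
  ultimately have "c ^ (n - 1) * (real (n * (n - 1)) * t * c) = c ^ (n - 1) * (c ^ q * \<beta>)"
    by (simp only: power_add ac_simps)
  then have "real (n * (n - 1)) * t * c = c ^ q * \<beta>" using c0 by simp
  \<comment> \<open>The factor \<open>n - 3\<close> of the remaining \<open>c\<close> on the left
    meets the one in \<open>\<beta>\<close>.\<close>
  then have "(real n - 3) * (real n * (real n - 1)\<^sup>2 * t)
      = (real n - 3) * (c ^ q * (real n * (real n - 2)) ^ (n - 1))"
    by (simp add: c_def \<beta>_def m power2_eq_square algebra_simps)
  then have eq: "real n * (real n - 1)\<^sup>2 * t = c ^ q * (real n * (real n - 2)) ^ (n - 1)"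
    using n by simp
  \<comment> \<open>Makes the truncated exponent \<open>q - 2\<close> exact: two factors
    \<open>n - 1\<close> of \<open>c ^ q\<close> are divided out.\<close>
  have "q \<ge> 2" using q2 by (simp add: m algebra_simps)
  then obtain p where p: "q = p + 2" by (metis le_add_diff_inverse2)
  have "real n * (real n - 1)\<^sup>2 * t = real n * (real n - 1)\<^sup>2 *
      ((real n - 3) ^ q * (real n - 2) ^ (n - 1) * (real n - 1) ^ (q - 2) * real n ^ (n - 2))"
    unfolding eq c_def power_mult_distrib unfolding p m by (simp add: power_add ac_simps power2_eq_square power3_eq_cube)
  then have "t = (real n - 3) ^ q * (real n - 2) ^ (n - 1) * (real n - 1) ^ (q - 2) * real n ^ (n - 2)"
    using n by simp
  then show ?thesis
    unfolding t_def q_def using n by (simp add: of_nat_diff)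
qed

section \<open>Universal cycles as Eulerian trails\<close>

lemma finite_k_perms [simp]: "finite (k_perms n k)"
  unfolding k_perms_def
  by (rule finite_subset[OF _ finite_subset_distinct[of "{1..n}"]]) auto

lemma length_cyclic_window [simp]: "length (cyclic_window xs k i) = k"
  by (simp add: cyclic_window_def)

lemma cyclic_window_nth: "j < k \<Longrightarrow> cyclic_window xs k i ! j = xs ! ((i + j) mod length xs)"
  by (simp add: cyclic_window_def)

lemma cyclic_window_mod: "cyclic_window xs k (i mod length xs) = cyclic_window xs k i"
  by (simp add: cyclic_window_def mod_simps)

lemma cyclic_window_rotate:
  assumes "xs \<noteq> []"
  shows "cyclic_window (rotate m xs) k i = cyclic_window xs k (m + i)"
  using assms by (simp add: cyclic_window_def nth_rotate mod_simps add.assoc)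

text \<open>Positions and \<open>k\<close>-permutations are equally many, so windows that cover all
  permutations cover each exactly once.\<close>

lemma is_ucycle_iff:
  "is_ucycle n k xs \<longleftrightarrow> length xs = card (k_perms n k) \<and> set xs \<subseteq> {1..n} \<and>
    k_perms n k \<subseteq> cyclic_window xs k ` {..<length xs}"
proof safe
  assume "is_ucycle n k xs"
  then show "length xs = card (k_perms n k)" "\<And>x. x \<in> set xs \<Longrightarrow> x \<in> {1..n}"
    "\<And>p. p \<in> k_perms n k \<Longrightarrow> p \<in> cyclic_window xs k ` {..<length xs}"
    unfolding is_ucycle_def by blast+
next
  assume len: "length xs = card (k_perms n k)" and set: "set xs \<subseteq> {1..n}"
    and sub: "k_perms n k \<subseteq> cyclic_window xs k ` {..<length xs}"
  have "card (k_perms n k) \<le> card (cyclic_window xs k ` {..<length xs})"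
    by (rule card_mono) (use sub in auto)
  moreover have "card (cyclic_window xs k ` {..<length xs}) \<le> length xs"
    using card_image_le[of "{..<length xs}"] by simp
  ultimately have "inj_on (cyclic_window xs k) {..<length xs}"
    using len by (intro eq_card_imp_inj_on) auto
  then have "\<exists>!i. i < length xs \<and> cyclic_window xs k i = p" if "p \<in> k_perms n k" for p
    using sub that by (auto dest: inj_onD)
  with len set show "is_ucycle n k xs" by (simp add: is_ucycle_def)
qed

text \<open>The same count leaves no position for a window that is not a
  \<open>k\<close>-permutation.\<close>

lemma is_ucycle_bij_betw:
  assumes "is_ucycle n k xs"
  shows "bij_betw (cyclic_window xs k) {..<length xs} (k_perms n k)"
proof -
  have len: "length xs = card (k_perms n k)"
    and sub: "k_perms n k \<subseteq> cyclic_window xs k ` {..<length xs}"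
    using assms unfolding is_ucycle_iff by blast+
  have le: "card (cyclic_window xs k ` {..<length xs}) \<le> card (k_perms n k)"
    using card_image_le[of "{..<length xs}"] len by simp
  then have eq: "k_perms n k = cyclic_window xs k ` {..<length xs}"
    using sub by (intro card_seteq) auto
  then have "inj_on (cyclic_window xs k) {..<length xs}"
    using len by (intro eq_card_imp_inj_on) auto
  then show ?thesis using eq by (simp add: bij_betw_def)
qed

lemma is_ucycle_rotate:
  assumes "is_ucycle n k xs"
  shows "is_ucycle n k (rotate m xs)"
proof (cases "xs = []")
  case False
  have "(rotate m xs, xs) \<in> rotation_rel"
    using equiv_rotation_rel unfolding equiv_def sym_def rotation_rel_def by blast
  then obtain m' where m': "xs = rotate m' (rotate m xs)" by (auto simp: rotation_rel_def)
  have "cyclic_window xs k i \<in> cyclic_window (rotate m xs) k ` {..<length xs}" for i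
  proof -
    have "cyclic_window xs k i = cyclic_window (rotate m xs) k (m' + i)"
      using False by (subst m', subst cyclic_window_rotate) auto
    also have "\<dots> = cyclic_window (rotate m xs) k ((m' + i) mod length xs)"
      using cyclic_window_mod[of "rotate m xs" k "m' + i"] by simp
    finally show ?thesis using False by simp
  qed
  then show ?thesis using assms unfolding is_ucycle_iff by auto
qed (use assms in simp)

section \<open>Normal forms of rotation classes\<close>

definition rooted_ucycles :: "nat \<Rightarrow> nat list \<Rightarrow> nat list set" where
  "rooted_ucycles n p = {xs. is_ucycle n (length p) xs \<and> cyclic_window xs (length p) 0 = p}"

text \<open>Since \<open>p\<close> occurs at one position only, each rotation class has exactly one
  member that begins with \<open>p\<close>.\<close>

lemma bij_betw_rooted_ucycles:
  assumes p: "p \<in> k_perms n k"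
  shows "bij_betw (\<lambda>xs. rotation_rel `` {xs}) (rooted_ucycles n p) (ucycles n k)"
proof (rule bij_betw_imageI)
  have k: "length p = k" using p by (simp add: k_perms_def)
  show "inj_on (\<lambda>xs. rotation_rel `` {xs}) (rooted_ucycles n p)"
  proof (rule inj_onI)
    fix xs ys assume xs: "xs \<in> rooted_ucycles n p" and ys: "ys \<in> rooted_ucycles n p"
      and eq: "rotation_rel `` {xs} = rotation_rel `` {ys}"
    have "(xs, ys) \<in> rotation_rel"
      using eq eq_equiv_class_iff[OF equiv_rotation_rel, of xs ys] by simp
    then obtain m where m: "ys = rotate m xs" by (auto simp: rotation_rel_def)
    have bij: "bij_betw (cyclic_window xs k) {..<length xs} (k_perms n k)"
      using xs k by (intro is_ucycle_bij_betw) (simp add: rooted_ucycles_def)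
    then have ne: "xs \<noteq> []" using p by (auto simp: bij_betw_def)
    have "cyclic_window xs k (m mod length xs) = cyclic_window xs k 0"
      using xs ys k cyclic_window_rotate[OF ne, of m k 0]
      by (simp add: rooted_ucycles_def m cyclic_window_mod)
    then have "m mod length xs = 0"
      using bij ne by (auto simp: bij_betw_def dest!: inj_onD)
    then show "xs = ys" using m rotate_conv_mod[of m xs] by simp
  qed
  show "(\<lambda>xs. rotation_rel `` {xs}) ` rooted_ucycles n p = ucycles n k"
  proof (intro equalityI subsetI)
    fix C assume "C \<in> (\<lambda>xs. rotation_rel `` {xs}) ` rooted_ucycles n p"
    then show "C \<in> ucycles n k"
      using k by (auto simp: ucycles_def rooted_ucycles_def intro: quotientI)
  next
    fix C assume "C \<in> ucycles n k"
    then obtain xs where xs: "is_ucycle n k xs" and C: "C = rotation_rel `` {xs}"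
      by (auto simp: ucycles_def elim: quotientE)
    obtain i where i: "i < length xs" "cyclic_window xs k i = p"
      using is_ucycle_iff[of n k xs] xs p by auto
    then have "xs \<noteq> []" by auto
    then have "rotate i xs \<in> rooted_ucycles n p"
      using is_ucycle_rotate[OF xs] i k by (simp add: rooted_ucycles_def cyclic_window_rotate)
    moreover have "C = rotation_rel `` {rotate i xs}"
      unfolding C by (rule equiv_class_eq[OF equiv_rotation_rel]) (auto simp: rotation_rel_def)
    ultimately show "C \<in> (\<lambda>xs. rotation_rel `` {xs}) ` rooted_ucycles n p" by blast
  qed
qed

section \<open>Triples, arcs and closed walks\<close>

definition triple_arc :: "nat list \<Rightarrow> (nat \<times> nat) \<times> (nat \<times> nat)" where
  "triple_arc p = ((p ! 0, p ! 1), (p ! 1, p ! 2))"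

lemma triple_arc_eq_iff:
  assumes "length p = 3" "length q = 3"
  shows "triple_arc p = triple_arc q \<longleftrightarrow> p = q"
  using assms by (auto simp: triple_arc_def length_Suc_conv numeral_3_eq_3 numeral_2_eq_2)

lemma bij_betw_triple_arc: "bij_betw triple_arc (k_perms n 3) (pair_arcs n)"
proof (rule bij_betw_imageI)
  show "inj_on triple_arc (k_perms n 3)"
    by (rule inj_onI) (simp add: k_perms_def triple_arc_eq_iff)
  show "triple_arc ` k_perms n 3 = pair_arcs n"
  proof (intro equalityI subsetI)
    fix e assume "e \<in> triple_arc ` k_perms n 3"
    then show "e \<in> pair_arcs n"
      by (auto simp: triple_arc_def k_perms_def pair_arcs_def pairs_def length_Suc_conv
        numeral_3_eq_3 numeral_2_eq_2)
  next
    fix e assume e: "e \<in> pair_arcs n"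
    obtain a b c d where abcd: "e = ((a, b), (c, d))" by (metis surj_pair)
    have "e = triple_arc [a, b, d]" using e by (auto simp: abcd triple_arc_def pair_arcs_def)
    moreover have "[a, b, d] \<in> k_perms n 3"
      using e by (auto simp: abcd k_perms_def pair_arcs_def pairs_def)
    ultimately show "e \<in> triple_arc ` k_perms n 3" by blast
  qed
qed

text \<open>Positional form of \<open>walk\<close>, to be matched with windows, which are read by
  index.\<close>

lemma walk_iff_nth:
  "walk u es w \<longleftrightarrow> (if es = [] then u = w
     else fst (es ! 0) = u \<and> snd (es ! (length es - 1)) = w \<and>
       (\<forall>i. Suc i < length es \<longrightarrow> snd (es ! i) = fst (es ! Suc i)))"
proof (induction es arbitrary: u)
  case (Cons e es)
  have split: "(\<forall>i. Q i) \<longleftrightarrow> Q 0 \<and> (\<forall>i. Q (Suc i))" for Q :: "nat \<Rightarrow> bool"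
    by (metis nat.exhaust)
  have steps: "(\<forall>i. Suc i < length (e # es) \<longrightarrow> snd ((e # es) ! i) = fst ((e # es) ! Suc i)) \<longleftrightarrow>
      (es \<noteq> [] \<longrightarrow> snd e = fst (es ! 0)) \<and>
      (\<forall>i. Suc i < length es \<longrightarrow> snd (es ! i) = fst (es ! Suc i))"
    by (subst split) auto
  show ?case
  proof (cases "es = []")
    case False
    then have last: "(e # es) ! (length (e # es) - 1) = es ! (length es - 1)"
      by (simp add: nth_Cons')
    have "walk u (e # es) w \<longleftrightarrow> fst e = u \<and> snd e = fst (es ! 0) \<and>
        snd (es ! (length es - 1)) = w \<and> (\<forall>i. Suc i < length es \<longrightarrow> snd (es ! i) = fst (es ! Suc i))"
      using Cons.IH[of "snd e"] False by (simp only: walk.simps if_False eq_commute[of "snd e"])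
    then show ?thesis
      using False unfolding steps last nth_Cons_0 by (simp only: list.distinct if_False simp_thms) blast
  qed simp
qed simp

lemma closed_walk_nth:
  assumes "walk u es u" "i < length es"
  shows "snd (es ! i) = fst (es ! (Suc i mod length es))"
proof (cases "Suc i < length es")
  case False
  then have "Suc i = length es" "i = length es - 1" using assms(2) by simp_all
  then show ?thesis using assms by (auto simp: walk_iff_nth split: if_splits)
qed (use assms in \<open>auto simp: walk_iff_nth split: if_splits\<close>)

text \<open>Neighbouring windows overlap in two entries, also across the end of the list, so their
  arcs are consecutive.\<close>

lemma closed_trail_of_ucycle:
  assumes xs: "is_ucycle n 3 xs" and ne: "xs \<noteq> []"
  defines "es \<equiv> map (\<lambda>i. triple_arc (cyclic_window xs 3 i)) [0..<length xs]"
  shows "es \<in> trails (pair_arcs n) (fst (hd es)) (fst (hd es))"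
proof -
  have bij: "bij_betw (\<lambda>i. triple_arc (cyclic_window xs 3 i)) {..<length xs} (pair_arcs n)"
    using bij_betw_trans[OF is_ucycle_bij_betw[OF xs] bij_betw_triple_arc] by (simp add: comp_def)
  have "distinct es" "set es = pair_arcs n"
    using bij by (auto simp: es_def distinct_map bij_betw_def atLeast0LessThan)
  moreover have nth: "es ! i = triple_arc (cyclic_window xs 3 i)" if "i < length xs" for i
    using that by (simp add: es_def)
  have len: "length es = length xs" by (simp add: es_def)
  have hd: "hd es = es ! 0" using ne by (simp add: hd_conv_nth es_def)
  have "walk (fst (hd es)) es (fst (hd es))"
  proof -
    obtain l where l: "length xs = Suc l" using ne by (cases xs) auto
    have "snd (es ! (length xs - 1)) = fst (es ! 0)"
      by (simp add: l nth triple_arc_def cyclic_window_nth mod_Suc)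
    moreover have "snd (es ! i) = fst (es ! Suc i)" if "Suc i < length xs" for i
      using that by (simp add: nth triple_arc_def cyclic_window_nth)
    ultimately show ?thesis using ne len by (auto simp: walk_iff_nth hd)
  qed
  ultimately show ?thesis by (simp add: trails_def)
qed

text \<open>The entries of the window at \<open>i\<close> are the first components of the tails of
  three cyclically consecutive arcs; since the arcs overlap, these entries determine arc
  \<open>i\<close>.\<close>

lemma triple_arc_closed_trail:
  assumes es: "es \<in> trails (pair_arcs n) u u" and i: "i < length es"
  shows "triple_arc (cyclic_window (map (fst \<circ> fst) es) 3 i) = es ! i"
proof -
  let ?L = "length es"
  have arc: "snd (fst (es ! j)) = fst (snd (es ! j))" if "j < ?L" for j
    using es nth_mem[OF that] by (auto simp: trails_def pair_arcs_def)
  have step: "snd (es ! j) = fst (es ! (Suc j mod ?L))" if "j < ?L" for j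
    using es closed_walk_nth[of u es j] that by (simp add: trails_def)
  define j where "j = Suc i mod ?L"
  have pos: "0 < ?L" using i by linarith
  have j: "j < ?L" using pos by (simp add: j_def)
  have "Suc j mod ?L = (i + 2) mod ?L" by (simp add: j_def mod_Suc_eq)
  then have "fst (snd (es ! j)) = fst (fst (es ! ((i + 2) mod ?L)))" using step[OF j] by simp
  moreover have "es ! i = (fst (es ! i), fst (es ! j))" using step[OF i] by (simp add: j_def prod_eq_iff)
  moreover have "fst (es ! i) = (fst (fst (es ! i)), fst (fst (es ! j)))"
    using step[OF i] arc[OF i] by (simp add: j_def prod_eq_iff)
  moreover have "fst (es ! j) = (fst (fst (es ! j)), fst (snd (es ! j)))"
    using arc[OF j] by (simp add: prod_eq_iff)
  ultimately have "es ! i = ((fst (fst (es ! i)), fst (fst (es ! j))),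
      (fst (fst (es ! j)), fst (fst (es ! ((i + 2) mod ?L)))))"
    by metis
  then show ?thesis
    using i j pos by (simp add: triple_arc_def cyclic_window_nth j_def)
qed

text \<open>The inverse takes the first entry of the tail of each arc. Fixing the first arc
  corresponds to fixing the window at position 0.\<close>

lemma bij_betw_ucycle_trails:
  assumes p: "p \<in> k_perms n 3"
  shows "bij_betw (\<lambda>xs. map (\<lambda>i. triple_arc (cyclic_window xs 3 i)) [0..<length xs])
    (rooted_ucycles n p)
    {es \<in> trails (pair_arcs n) (fst (triple_arc p)) (fst (triple_arc p)). hd es = triple_arc p}"
    (is "bij_betw ?g _ ?T")
proof (rule bij_betw_byWitness[where f' = "map (fst \<circ> fst)"])
  have p3: "length p = 3" using p by (simp add: k_perms_def)
  have ne: "xs \<noteq> []" if "xs \<in> rooted_ucycles n p" for xs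
    using that p p3 by (auto simp: rooted_ucycles_def is_ucycle_def)
  show "\<forall>xs\<in>rooted_ucycles n p. map (fst \<circ> fst) (?g xs) = xs"
    by (auto intro!: nth_equalityI simp: triple_arc_def cyclic_window_nth)
  show "\<forall>es\<in>?T. ?g (map (fst \<circ> fst) es) = es"
    by (auto intro!: nth_equalityI simp: triple_arc_closed_trail)
  show "?g ` rooted_ucycles n p \<subseteq> ?T"
  proof (rule image_subsetI)
    fix xs assume xs: "xs \<in> rooted_ucycles n p"
    have "hd (?g xs) = triple_arc p"
      using ne[OF xs] xs p3 by (simp add: hd_map rooted_ucycles_def)
    then show "?g xs \<in> ?T"
      using closed_trail_of_ucycle[OF _ ne[OF xs], of n] xs p3 by (simp add: rooted_ucycles_def)
  qed
  show "map (fst \<circ> fst) ` ?T \<subseteq> rooted_ucycles n p"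
  proof (rule image_subsetI)
    fix es assume "es \<in> ?T"
    then have es: "es \<in> trails (pair_arcs n) (fst (triple_arc p)) (fst (triple_arc p))"
      and hd: "hd es = triple_arc p" by auto
    let ?xs = "map (fst \<circ> fst) es"
    have set: "set es = pair_arcs n" and dist: "distinct es" using es by (auto simp: trails_def)
    have "card (pair_arcs n) = card (k_perms n 3)"
      using bij_betw_same_card[OF bij_betw_triple_arc] by simp
    then have len: "length ?xs = card (k_perms n 3)"
      using distinct_card[OF dist] set by simp
    have window: "\<exists>i<length ?xs. cyclic_window ?xs 3 i = q" if q: "q \<in> k_perms n 3" for q
    proof -
      have "triple_arc q \<in> set es" using q bij_betw_triple_arc set by (auto simp: bij_betw_def)
      then obtain i where i: "i < length es" "es ! i = triple_arc q" by (auto simp: in_set_conv_nth)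
      then have "triple_arc (cyclic_window ?xs 3 i) = triple_arc q"
        using triple_arc_closed_trail[OF es i(1)] by simp
      then have "cyclic_window ?xs 3 i = q"
        using q by (subst (asm) triple_arc_eq_iff) (auto simp: k_perms_def)
      with i show ?thesis by auto
    qed
    have "length es > 0" using window[OF p] by auto
    then have "triple_arc (cyclic_window ?xs 3 0) = triple_arc p"
      using triple_arc_closed_trail[OF es, of 0] hd by (simp add: hd_conv_nth)
    then have "cyclic_window ?xs 3 0 = p" using p3 by (subst (asm) triple_arc_eq_iff) auto
    moreover have "set ?xs \<subseteq> {1..n}" using set by (auto simp: pair_arcs_def pairs_def)
    moreover have "k_perms n 3 \<subseteq> cyclic_window ?xs 3 ` {..<length ?xs}" using window by blast
    ultimately show "?xs \<in> rooted_ucycles n p"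
      using len p3 by (simp add: rooted_ucycles_def is_ucycle_iff)
  qed
qed

section \<open>The number of universal cycles\<close>

lemma trails_with_first:
  assumes e: "e \<in> E"
  shows "{es \<in> trails E (fst e) w. hd es = e} = (#) e ` trails (E - {e}) (snd e) w"
    (is "?A = ?B")
proof (intro equalityI subsetI)
  fix es assume es: "es \<in> ?A"
  then obtain fs where fs: "es = e # fs" using e by (cases es) (auto simp: trails_def)
  then have "e \<notin> set fs" "insert e (set fs) = E" "distinct fs" "walk (snd e) fs w"
    using es by (simp_all add: trails_def)
  moreover from this have "set fs = E - {e}" by blast
  ultimately have "fs \<in> trails (E - {e}) (snd e) w" by (simp add: trails_def)
  then show "es \<in> ?B" unfolding fs by simp
next
  fix es assume "es \<in> ?B"
  then obtain fs where "es = e # fs" "fs \<in> trails (E - {e}) (snd e) w" by blast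
  moreover have "insert e (E - {e}) = E" using e by blast
  ultimately show "es \<in> ?A" by (simp add: trails_def)
qed

text \<open>Every rotation class is cut at its window \<open>[1, 2, 3]\<close>. The first arc is
  thereby prescribed, and dropping it leaves open trails of the kind counted by
  \<open>card_trails\<close>.\<close>

lemma card_ucycles_eq_trails:
  assumes n: "n \<ge> 3"
  shows "card (ucycles n 3) = card (trails (pair_arcs n - {((1, 2), (2, 3))}) (2, 3) (1, 2))"
proof -
  let ?e = "((1, 2), (2, 3)) :: (nat \<times> nat) \<times> nat \<times> nat"
  have p: "[1, 2, 3] \<in> k_perms n 3" using n by (auto simp: k_perms_def)
  have arc: "triple_arc [1, 2, 3] = ?e" by (simp add: triple_arc_def)
  have e: "?e \<in> pair_arcs n" using n by (auto simp: pair_arcs_def pairs_def)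
  have "card (ucycles n 3) = card {es \<in> trails (pair_arcs n) (fst ?e) (1, 2). hd es = ?e}"
    using trans[OF bij_betw_same_card[OF bij_betw_rooted_ucycles[OF p], symmetric]
      bij_betw_same_card[OF bij_betw_ucycle_trails[OF p]]] by (simp only: arc fst_conv)
  also have "\<dots> = card ((#) ?e ` trails (pair_arcs n - {?e}) (snd ?e) (1, 2))"
    by (simp only: trails_with_first[OF e])
  finally show ?thesis by (simp add: card_image)
qed

theorem theorem2:
  fixes n :: nat
  assumes "n \<ge> 4"
  shows "card (ucycles n 3) =
    (n - 3) ^ ((n - 1) * (n - 2) div 2) *
    (n - 2) ^ (n - 1) *
    (n - 1) ^ ((n - 1) * (n - 2) div 2 - 2) *
    n ^ (n - 2) *
    (fact (n - 3)) ^ (n * (n - 1))"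
proof -
  let ?E = "pair_arcs n" and ?V = "pairs n" and ?w = "(1, 2) :: nat \<times> nat"
  let ?e = "((1, 2), (2, 3)) :: (nat \<times> nat) \<times> nat \<times> nat"
  have n3: "n \<ge> 3" using assms by simp
  have finE: "finite ?E" by (rule finite_subset[OF pair_arcs_subset]) simp
  have e: "?e \<in> ?E" and w: "?w \<in> ?V" using assms by (auto simp: pair_arcs_def pairs_def)
  have deg: "outdeg ?E v = indeg ?E v" for v
    by (cases "v \<in> ?V") (simp_all add: outdeg_pair_arcs indeg_pair_arcs outdeg_outside indeg_outside)
  have "real (card (ucycles n 3))
      = Det ?V (rooted_laplacian (?E - {?e}) ?w) * trail_weight ?V (?E - {?e}) ?w"
    unfolding card_ucycles_eq_trails[OF n3]
  proof (rule card_trails)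
    show "?E - {?e} \<subseteq> ?V \<times> ?V" using pair_arcs_subset by blast
    show "fst e' \<noteq> snd e'" if "e' \<in> ?E - {?e}" for e'
      using that by (auto simp: pair_arcs_def pairs_def)
    show "outdeg (?E - {?e}) v + (if v = ?w then 1 else 0)
        = indeg (?E - {?e}) v + (if v = (2, 3) then 1 else 0)" for v
      using deg[of v] outdeg_remove[OF finE e, of v] indeg_remove[OF finE e, of v] by simp
  qed (use w assms in \<open>auto simp: pairs_def\<close>)
  \<comment> \<open>The dropped arc leaves the root, so the minor is that of the whole
    digraph.\<close>
  also have "rooted_laplacian (?E - {?e}) ?w = rooted_laplacian ?E ?w"
    by (rule rooted_laplacian_remove_root[OF finE e]) simp
  finally have card: "real (card (ucycles n 3))
      = Det ?V (rooted_laplacian ?E ?w) * trail_weight ?V (?E - {?e}) ?w" .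
  \<comment> \<open>Dropping that arc divides \<open>fact (n - 2)\<close> at the root by
    \<open>n - 2\<close>, so each of the \<open>n * (n - 1)\<close> vertices contributes
    \<open>fact (n - 3)\<close>.\<close>
  have "trail_weight ?V ?E ?w = real (n - 2) * trail_weight ?V (?E - {?e}) ?w"
    using trail_weight_remove_root[OF finE e, of ?w ?V] w by (simp add: outdeg_pair_arcs)
  moreover have "trail_weight ?V ?E ?w = fact (n - 2) * fact (n - 3) ^ (n * (n - 1) - 1)"
    using w by (simp add: trail_weight_def outdeg_pair_arcs card_pairs numeral_3_eq_3 numeral_2_eq_2)
  moreover have "(fact (n - 2) :: real) = real (n - 2) * fact (n - 3)"
    using fact_reduce[of "n - 2", where 'a = real] assms by (simp add: numeral_3_eq_3 numeral_2_eq_2)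
  moreover have "fact (n - 3) ^ (n * (n - 1)) = (fact (n - 3) * fact (n - 3) ^ (n * (n - 1) - 1) :: real)"
    using assms by (subst power_eq_if) simp
  ultimately have weight: "trail_weight ?V (?E - {?e}) ?w = fact (n - 3) ^ (n * (n - 1))"
    using assms by simp
  \<comment> \<open>The determinant is a cardinality divided by a positive weight.\<close>
  have "Det ?V (rooted_laplacian ?E ?w) \<ge> 0"
    using card unfolding weight
    by (metis fact_gt_zero mult_neg_pos not_le of_nat_0_le_iff zero_less_power)
  from card[unfolded weight Det_rooted_laplacian_pair_arcs[OF assms w this]]
  have "real (card (ucycles n 3)) = real ((n - 3) ^ ((n - 1) * (n - 2) div 2) *
    (n - 2) ^ (n - 1) * (n - 1) ^ ((n - 1) * (n - 2) div 2 - 2) *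
    n ^ (n - 2) * (fact (n - 3)) ^ (n * (n - 1)))"
    by simp
  then show ?thesis by (rule of_nat_eq_iff[THEN iffD1])
qed

end
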